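(* Let $1<p<+\infty$. The sequence of Gr\"unwald--Durrmeyer operators $\{\mathcal{D}_n:L^p[0,\pi]\to L^p[0,\pi]\}_{n\in\mathbb{N}}$ is uniformly bounded: there is a constant $C_p>0$ such that $\|\mathcal{D}_n(f)\|_p\le C_p\|f\|_p$ for all $n\in\{1,2,\dots\}$ and all $f\in L^p[0,\pi]$.
   Context: For $n=1,2,\dots$ and $k=1,\dots,n$ let $\theta_k^{(n)}=\frac{2k-1}{2n}\pi$ and \[ P_k(t)=(-1)^{k+1}\frac{\cos(nt)\,\sin\theta_k^{(n)}}{n\,(\cos t-\cos\theta_k^{(n)})},\qquad t\in\mathbb{R}, \] where the (removable) singularities are filled in by continuity ($P_k$ depends on $n$ as well). Put \[ S_{k,n}(t)=\tfrac12\left(P_k\!\left(t-\tfrac{\pi}{2n}\right)+P_k\!\left(t+\tfrac{\pi}{2n}\right)\right). \] The $n$-th Gr\"unwald--Durrmeyer operator is defined, for $f\in L^p[0,\pi]$ ($1\le p\le+\infty$, Lebesgue measure) and $\theta\in[0,\pi]$, by \[ \mathcal{D}_n(f)(\theta)=\frac{n}{\pi}\sum_{k=1}^n S_{k,n}(\theta)\int_0^\pi f(t)\,S_{k,n}(t)\,dt . \] $\|\cdot\|_p$ is the usual norm of $L^p[0,\pi]$. *)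

theory Defs
  imports "HOL-Analysis.Analysis"
begin

definition node :: "nat \<Rightarrow> nat \<Rightarrow> real" where
  "node n k = (2 * real k - 1) / (2 * real n) * pi"

definition basis_quot :: "nat \<Rightarrow> nat \<Rightarrow> real \<Rightarrow> real" where
  "basis_quot n k t =
     (-1) ^ (k + 1) * (cos (real n * t) * sin (node n k))
       / (real n * (cos t - cos (node n k)))"

(* For 1 <= k <= n the zeros of the denominator are simple and are zeros of the
   numerator, so the limit exists and P is the continuous extension of the quotient. *)
definition P :: "nat \<Rightarrow> nat \<Rightarrow> real \<Rightarrow> real" where
  "P n k t = (if cos t = cos (node n k) then Lim (at t) (basis_quot n k)
              else basis_quot n k t)"

definition S :: "nat \<Rightarrow> nat \<Rightarrow> real \<Rightarrow> real" where
  "S n k t = (P n k (t - pi / (2 * real n)) + P n k (t + pi / (2 * real n))) / 2"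

definition grunwald_durrmeyer :: "nat \<Rightarrow> (real \<Rightarrow> real) \<Rightarrow> real \<Rightarrow> real" where
  "grunwald_durrmeyer n f \<theta> =
     real n / pi *
       (\<Sum>k = 1..n. S n k \<theta> * (\<integral>t. f t * S n k t \<partial>lebesgue_on {0..pi}))"

(* L^p[0,pi] for finite p, through representatives: functions are not identified
   when they agree almost everywhere, so Lp_norm is a seminorm on Lp_space p.
   Values outside [0,pi] are irrelevant. *)
definition Lp_space :: "real \<Rightarrow> (real \<Rightarrow> real) set" where
  "Lp_space p = {f \<in> borel_measurable (lebesgue_on {0..pi}).
     integrable (lebesgue_on {0..pi}) (\<lambda>t. \<bar>f t\<bar> powr p)}"

definition Lp_norm :: "real \<Rightarrow> (real \<Rightarrow> real) \<Rightarrow> real" where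
  "Lp_norm p f = (\<integral>t. \<bar>f t\<bar> powr p \<partial>lebesgue_on {0..pi}) powr (1 / p)"

end

theory Submission
  imports Defs
begin

text \<open>
  Averaging over the shifts \<open>\<plusminus> pi / (2 n)\<close> makes the basis functions decay quadratically:
  \<open>\<bar>S n k t\<bar>\<close> is at most a constant times \<open>w k t = h\<^sup>2 / (h\<^sup>2 + (t - node n k)\<^sup>2)\<close> with
  \<open>h = pi / (2 n)\<close>. Since the nodes have spacing \<open>2 h\<close>, the sum of the \<open>w k t\<close> over \<open>k\<close> is bounded
  and the integral of each \<open>w k\<close> is \<open>O(1 / n)\<close>. Two applications of Jensen's inequality, one for
  the weights \<open>w k t\<close> in \<open>k\<close> and one for the weight \<open>w k\<close> in \<open>t\<close>, as in the Schur test, then give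
  the bound.
\<close>

section \<open>A finite-rank Schur test\<close>

text \<open>The convex function \<open>x powr p\<close> lies above its tangent at \<open>a\<close>,
  with terms moved so that nothing is subtracted. It is Young's inequality for \<open>x\<close> and
  \<open>a powr (p - 1)\<close>, with exponents \<open>p\<close> and
  \<open>p / (p - 1)\<close>.\<close>

lemma powr_tangent_le:
  fixes a x p :: real
  assumes "1 < p" "0 \<le> a" "0 \<le> x"
  shows "p * a powr (p - 1) * x \<le> x powr p + (p - 1) * a powr p"
proof -
  have *: "1 / p + 1 / (p / (p - 1)) = 1" "1 < p / (p - 1)"
    using assms by (simp_all add: field_simps)
  have "x * a powr (p - 1) \<le> x powr p / p + (a powr (p - 1)) powr (p / (p - 1)) / (p / (p - 1))"
    using assms * by (intro Youngs_inequality) auto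
  also have "(a powr (p - 1)) powr (p / (p - 1)) = a powr p"
    using assms by (simp add: powr_powr)
  finally show ?thesis
    using assms by (simp add: field_simps)
qed

text \<open>Jensen's inequality for the measure with density \<open>w\<close>, whose mass is only
  bounded by \<open>A\<close>. Multiplying the tangent inequality by \<open>w\<close> and
  integrating avoids normalising the measure, so mass zero is no special case.\<close>

lemma powr_weighted_integral_le:
  fixes w g :: "'a \<Rightarrow> real"
  assumes p: "1 < p" and A: "0 < A"
    and w: "\<And>x. x \<in> space M \<Longrightarrow> 0 \<le> w x" and g: "\<And>x. x \<in> space M \<Longrightarrow> 0 \<le> g x"
    and iw: "integrable M w" and iwg: "integrable M (\<lambda>x. w x * g x)"
    and iwp: "integrable M (\<lambda>x. w x * g x powr p)"
    and le: "(\<integral>x. w x \<partial>M) \<le> A"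
  shows "(\<integral>x. w x * g x \<partial>M) powr p \<le> A powr (p - 1) * (\<integral>x. w x * g x powr p \<partial>M)"
proof -
  \<comment> \<open>The mean of \<open>g\<close> relative to the bound \<open>A\<close> is the
    tangent point. The linear term then becomes \<open>p * (a powr p * A)\<close>, and subtracting
    the constant term leaves exactly \<open>a powr p * A\<close>.\<close>
  define a where "a = (\<integral>x. w x * g x \<partial>M) / A"
  have nn: "0 \<le> (\<integral>x. w x * g x \<partial>M)"
    using w g by (intro Bochner_Integration.integral_nonneg) simp
  hence a: "0 \<le> a" using A by (simp add: a_def)
  have "p * a powr (p - 1) * (\<integral>x. w x * g x \<partial>M) = (\<integral>x. p * a powr (p - 1) * (w x * g x) \<partial>M)"
    by simp
  also have "\<dots> \<le> (\<integral>x. w x * g x powr p + (p - 1) * a powr p * w x \<partial>M)"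
  proof (rule integral_mono)
    fix x assume x: "x \<in> space M"
    show "p * a powr (p - 1) * (w x * g x) \<le> w x * g x powr p + (p - 1) * a powr p * w x"
      using mult_left_mono[OF powr_tangent_le[OF p a g[OF x]] w[OF x]]
      by (simp add: algebra_simps)
  qed (use iw iwg iwp in auto)
  also have "\<dots> = (\<integral>x. w x * g x powr p \<partial>M) + (p - 1) * a powr p * (\<integral>x. w x \<partial>M)"
    using iw iwp by simp
  also have "\<dots> \<le> (\<integral>x. w x * g x powr p \<partial>M) + (p - 1) * a powr p * A"
    using le p by (intro add_left_mono mult_left_mono) auto
  finally have "p * a powr (p - 1) * (a * A)
      \<le> (\<integral>x. w x * g x powr p \<partial>M) + (p - 1) * a powr p * A"
    using A by (simp add: a_def)
  moreover have "a powr (p - 1) * a = a powr p"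
    using a by (simp add: powr_mult_base[symmetric] powr_diff)
  hence "p * a powr (p - 1) * (a * A) = p * (a powr p * A)"
    by simp
  ultimately have *: "a powr p * A \<le> (\<integral>x. w x * g x powr p \<partial>M)"
    by (simp add: left_diff_distrib)
  have "(\<integral>x. w x * g x \<partial>M) powr p = (a * A) powr p"
    using A by (simp add: a_def)
  also have "\<dots> = A powr (p - 1) * (a powr p * A)"
    using A a by (simp add: powr_mult powr_diff)
  finally show ?thesis
    using * by (simp add: mult_left_mono)
qed

lemma powr_weighted_sum_le:
  fixes w g :: "'a \<Rightarrow> real"
  assumes "1 < p" "0 < A" "finite I"
    and "\<And>i. i \<in> I \<Longrightarrow> 0 \<le> w i" "\<And>i. i \<in> I \<Longrightarrow> 0 \<le> g i" "(\<Sum>i\<in>I. w i) \<le> A"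
  shows "(\<Sum>i\<in>I. w i * g i) powr p \<le> A powr (p - 1) * (\<Sum>i\<in>I. w i * g i powr p)"
  using powr_weighted_integral_le[of p A "count_space I" w g] assms
  by (simp add: integrable_count_space lebesgue_integral_count_space_finite)

text \<open>Jensen over \<open>i\<close> bounds the p-th power of \<open>T\<close> by
  \<open>A powr (p - 1)\<close> times the sum of \<open>w i x * c i powr p\<close>. Integrating in
  \<open>x\<close> yields a factor \<open>B\<close>, Jensen in \<open>t\<close> for each
  \<open>c i\<close> yields \<open>B powr (p - 1)\<close>, and the pointwise bound on the sum of the
  weights yields the last factor \<open>A\<close>. Domination almost everywhere leaves room for the
  exceptional points of \<open>s\<close>.\<close>

lemma finite_rank_powr_bound:
  fixes s w :: "'i \<Rightarrow> 'a \<Rightarrow> real"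
  assumes p: "1 < p" and A: "0 < A" and B: "0 < B" and fin: "finite I"
    and ms: "\<And>i. i \<in> I \<Longrightarrow> s i \<in> borel_measurable M"
    and sw: "\<And>i. i \<in> I \<Longrightarrow> AE x in M. \<bar>s i x\<bar> \<le> w i x"
    and w0: "\<And>i x. i \<in> I \<Longrightarrow> 0 \<le> w i x"
    and iw: "\<And>i. i \<in> I \<Longrightarrow> integrable M (w i)"
    and wA: "\<And>x. x \<in> space M \<Longrightarrow> (\<Sum>i\<in>I. w i x) \<le> A"
    and wB: "\<And>i. i \<in> I \<Longrightarrow> (\<integral>x. w i x \<partial>M) \<le> B"
    and mf: "f \<in> borel_measurable M" and fp: "integrable M (\<lambda>x. \<bar>f x\<bar> powr p)"
  defines "T \<equiv> \<lambda>x. \<Sum>i\<in>I. s i x * (\<integral>t. f t * s i t \<partial>M)"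
  shows "integrable M (\<lambda>x. \<bar>T x\<bar> powr p)"
    and "(\<integral>x. \<bar>T x\<bar> powr p \<partial>M) \<le> (A * B) powr p * (\<integral>x. \<bar>f x\<bar> powr p \<partial>M)"
proof -
  define c where "c = (\<lambda>i. \<integral>t. w i t * \<bar>f t\<bar> \<partial>M)"
  define G where "G = (\<lambda>x. A powr (p - 1) * (\<Sum>i\<in>I. w i x * c i powr p))"
  have mw: "w i \<in> borel_measurable M" if "i \<in> I" for i
    using iw[OF that] by auto
  have wA1: "w i x \<le> A" if "i \<in> I" "x \<in> space M" for i x
    using member_le_sum[of i I "\<lambda>i. w i x"] w0 fin wA[OF that(2)] that(1) by force
  have iwp: "integrable M (\<lambda>x. w i x * \<bar>f x\<bar> powr p)" if i: "i \<in> I" for i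
  proof (rule Bochner_Integration.integrable_bound[of _ "\<lambda>x. A * \<bar>f x\<bar> powr p"])
    show "AE x in M. norm (w i x * \<bar>f x\<bar> powr p) \<le> norm (A * \<bar>f x\<bar> powr p)"
      using wA1[OF i] w0[OF i] A by (intro AE_I2) (auto simp: abs_mult intro!: mult_right_mono)
  qed (use mw[OF i] mf fp in auto)
  have iwf: "integrable M (\<lambda>x. w i x * \<bar>f x\<bar>)" if i: "i \<in> I" for i
  proof (rule Bochner_Integration.integrable_bound)
    show "integrable M (\<lambda>x. w i x + w i x * \<bar>f x\<bar> powr p)"
      using iw[OF i] iwp[OF i] by simp
    \<comment> \<open>Multiplied by \<open>w i x\<close>, this majorises
      \<open>w i x * \<bar>f x\<bar>\<close> by two functions already known to be
      integrable.\<close>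
    have *: "\<bar>f x\<bar> \<le> 1 + \<bar>f x\<bar> powr p" for x
    proof (cases "\<bar>f x\<bar> \<le> 1")
      case False
      thus ?thesis using powr_mono[of 1 p "\<bar>f x\<bar>"] p by simp
    qed (simp add: add_increasing2)
    have "\<bar>w i x * \<bar>f x\<bar>\<bar> \<le> \<bar>w i x + w i x * \<bar>f x\<bar> powr p\<bar>" for x
      using mult_left_mono[OF *[of x] w0[OF i, of x]] w0[OF i, of x]
      by (simp add: algebra_simps abs_mult)
    thus "AE x in M. norm (w i x * \<bar>f x\<bar>) \<le> norm (w i x + w i x * \<bar>f x\<bar> powr p)"
      by simp
  qed (use mw[OF i] mf in auto)
  have c0: "0 \<le> c i" if "i \<in> I" for i
    unfolding c_def using w0[OF that] by (intro Bochner_Integration.integral_nonneg) simp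
  have cs: "\<bar>\<integral>t. f t * s i t \<partial>M\<bar> \<le> c i" if i: "i \<in> I" for i
  proof -
    have le: "AE t in M. \<bar>f t * s i t\<bar> \<le> w i t * \<bar>f t\<bar>"
      using sw[OF i]
      by eventually_elim (use w0[OF i] in \<open>auto simp: abs_mult mult.commute intro!: mult_left_mono\<close>)
    have "integrable M (\<lambda>t. \<bar>f t * s i t\<bar>)"
      using mf ms[OF i] le w0[OF i]
      by (intro Bochner_Integration.integrable_bound[OF iwf[OF i]]) auto
    hence "(\<integral>t. \<bar>f t * s i t\<bar> \<partial>M) \<le> c i"
      unfolding c_def using iwf[OF i] le by (rule integral_mono_AE)
    thus ?thesis
      using integral_abs_bound[of M "\<lambda>t. f t * s i t"] by linarith
  qed
  have cp: "c i powr p \<le> B powr (p - 1) * (\<integral>x. w i x * \<bar>f x\<bar> powr p \<partial>M)" if i: "i \<in> I" for i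
    unfolding c_def using w0[OF i] iw[OF i] iwf[OF i] iwp[OF i] wB[OF i] p B
    by (intro powr_weighted_integral_le) auto
  have TG: "AE x in M. \<bar>T x\<bar> powr p \<le> G x"
  proof -
    have "AE x in M. \<forall>i\<in>I. \<bar>s i x\<bar> \<le> w i x"
      using sw fin by (simp add: AE_finite_all)
    thus ?thesis
    proof (rule AE_mp, intro AE_I2 impI)
      fix x assume x: "x \<in> space M" and s: "\<forall>i\<in>I. \<bar>s i x\<bar> \<le> w i x"
      have "\<bar>T x\<bar> \<le> (\<Sum>i\<in>I. \<bar>s i x * (\<integral>t. f t * s i t \<partial>M)\<bar>)"
        unfolding T_def by (rule sum_abs)
      also have "\<dots> \<le> (\<Sum>i\<in>I. w i x * c i)"
        using s cs w0 unfolding abs_mult by (intro sum_mono mult_mono) auto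
      finally have "\<bar>T x\<bar> powr p \<le> (\<Sum>i\<in>I. w i x * c i) powr p"
        using p by (intro powr_mono2) auto
      also have "\<dots> \<le> G x"
        unfolding G_def using p A fin w0 c0 wA[OF x] by (intro powr_weighted_sum_le) auto
      finally show "\<bar>T x\<bar> powr p \<le> G x" .
    qed
  qed
  have mT: "T \<in> borel_measurable M"
    unfolding T_def using ms by (intro borel_measurable_sum) auto
  have iG: "integrable M G"
    unfolding G_def using iw by auto
  have G0: "0 \<le> G x" for x
    unfolding G_def using w0 by (intro mult_nonneg_nonneg sum_nonneg) auto
  show iT: "integrable M (\<lambda>x. \<bar>T x\<bar> powr p)"
    using TG mT by (intro Bochner_Integration.integrable_bound[OF iG]) (auto simp: G0)
  have "(\<integral>x. \<bar>T x\<bar> powr p \<partial>M) \<le> (\<integral>x. G x \<partial>M)"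
    using iT iG TG by (rule integral_mono_AE)
  also have "\<dots> = A powr (p - 1) * (\<Sum>i\<in>I. (\<integral>x. w i x \<partial>M) * c i powr p)"
    unfolding G_def using iw by simp
  also have "\<dots> \<le> A powr (p - 1) *
      (\<Sum>i\<in>I. B * (B powr (p - 1) * (\<integral>x. w i x * \<bar>f x\<bar> powr p \<partial>M)))"
    using wB cp B by (intro mult_left_mono sum_mono mult_mono) auto
  also have "\<dots> = A powr (p - 1) * B powr p * (\<integral>x. (\<Sum>i\<in>I. w i x * \<bar>f x\<bar> powr p) \<partial>M)"
    using iwp B by (simp add: sum_distrib_left mult_ac powr_diff)
  \<comment> \<open>The bound \<open>A\<close> on the sum of the weights enters a second time, now
    at the integration variable of \<open>f\<close>, and completes \<open>A powr (p - 1)\<close> to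
    \<open>A powr p\<close>.\<close>
  also have "\<dots> \<le> A powr (p - 1) * B powr p * (\<integral>x. A * \<bar>f x\<bar> powr p \<partial>M)"
  proof (intro mult_left_mono integral_mono)
    fix x assume "x \<in> space M"
    thus "(\<Sum>i\<in>I. w i x * \<bar>f x\<bar> powr p) \<le> A * \<bar>f x\<bar> powr p"
      using wA by (simp add: sum_distrib_right[symmetric] mult_right_mono)
  qed (use iwp fp in auto)
  also have "\<dots> = (A * B) powr p * (\<integral>x. \<bar>f x\<bar> powr p \<partial>M)"
    using A B by (simp add: powr_mult powr_diff)
  finally show "(\<integral>x. \<bar>T x\<bar> powr p \<partial>M) \<le> (A * B) powr p * (\<integral>x. \<bar>f x\<bar> powr p \<partial>M)" .
qed

section \<open>Bounds for the averaged basis functions\<close>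

text \<open>Christoffel-Darboux identity for the Chebyshev polynomials in the variables
  \<open>cos x\<close> and \<open>cos y\<close>. The induction step is the three-term recurrence,
  applied once in each variable. It serves to rewrite the quotient \<open>P\<close> as a cosine
  sum.\<close>

lemma Christoffel_Darboux_cos:
  fixes x y :: real
  shows "(1 + 2 * (\<Sum>j = 1..m. cos (real j * x) * cos (real j * y))) * (cos y - cos x)
    = cos (real (Suc m) * y) * cos (real m * x) - cos (real m * y) * cos (real (Suc m) * x)"
proof (induction m)
  case (Suc m)
  have *: "2 * cos z * cos (real (Suc m) * z)
      = cos (real (Suc (Suc m)) * z) + cos (real m * z)" for z :: real
    using cos_times_cos[of "real (Suc m) * z" z] by (simp add: algebra_simps)
  have "(1 + 2 * (\<Sum>j = 1..Suc m. cos (real j * x) * cos (real j * y))) * (cos y - cos x)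
     = (1 + 2 * (\<Sum>j = 1..m. cos (real j * x) * cos (real j * y))) * (cos y - cos x)
       + cos (real (Suc m) * x) * (2 * cos y * cos (real (Suc m) * y))
       - cos (real (Suc m) * y) * (2 * cos x * cos (real (Suc m) * x))"
    by (simp add: algebra_simps del: of_nat_Suc)
  also note Suc.IH
  finally show ?case
    unfolding * by (simp add: algebra_simps del: of_nat_Suc)
qed simp

lemma n_mult_node:
  assumes "1 \<le> n"
  shows "real n * node n k = real k * pi - pi / 2"
  using assms by (simp add: node_def field_simps)

lemma cos_n_mult_node:
  assumes "1 \<le> n"
  shows "cos (real n * node n k) = 0"
  unfolding n_mult_node[OF assms] by (simp add: cos_diff)

lemma sin_n_mult_node:
  assumes "1 \<le> n"
  shows "sin (real n * node n k) = (-1) ^ (k + 1)"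
  unfolding n_mult_node[OF assms] by (simp add: sin_diff)

text \<open>With the first variable at a zero of \<open>cos (n * x)\<close>, one term of the
  Christoffel-Darboux identity vanishes and the other is the numerator of \<open>P\<close>. Hence
  \<open>P\<close> is \<open>1 / n\<close> times one plus twice a sum of \<open>n - 1\<close> terms
  of modulus at most 1.\<close>

lemma abs_P_le:
  assumes n: "1 \<le> n" and t: "cos t \<noteq> cos (node n k)"
  shows "\<bar>P n k t\<bar> \<le> 2"
proof -
  define D where "D = 1 + 2 * (\<Sum>j = 1..n - 1. cos (real j * node n k) * cos (real j * t))"
  have eq: "cos (real (n - 1) * node n k) = (-1) ^ (k + 1) * sin (node n k)"
    using n sin_n_mult_node[OF n, of k] cos_n_mult_node[OF n, of k]
    by (simp add: of_nat_diff left_diff_distrib cos_diff)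
  have "D * (cos t - cos (node n k)) = cos (real n * t) * ((-1) ^ (k + 1) * sin (node n k))"
    using Christoffel_Darboux_cos[of "node n k" t "n - 1"] n eq
    by (simp add: D_def cos_n_mult_node)
  hence "D = cos (real n * t) * ((-1) ^ (k + 1) * sin (node n k)) / (cos t - cos (node n k))"
    using t by (metis nonzero_mult_div_cancel_right right_minus_eq)
  hence "P n k t = D / real n"
    using t n by (simp add: P_def basis_quot_def mult_ac)
  moreover have "\<bar>D\<bar> \<le> 2 * real n"
  proof -
    have "\<bar>\<Sum>j = 1..n - 1. cos (real j * node n k) * cos (real j * t)\<bar> \<le> (\<Sum>j = 1..n - 1. 1)"
      by (intro order.trans[OF sum_abs] sum_mono) (simp add: abs_mult mult_le_one)
    also have "\<dots> = real n - 1" using n by (simp add: of_nat_diff)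
    finally show ?thesis by (simp add: D_def)
  qed
  ultimately show ?thesis
    using n by (simp add: abs_divide pos_divide_le_eq)
qed

text \<open>A null set, so the limits in the definition of \<^const>\<open>P\<close> never have to be computed.\<close>

definition singular :: "nat \<Rightarrow> nat \<Rightarrow> real set" where
  "singular n k = {t. cos (t - pi / (2 * real n)) = cos (node n k)
                    \<or> cos (t + pi / (2 * real n)) = cos (node n k)}"

lemma countable_cos_eq: "countable {t. cos (t + a) = cos (b :: real)}"
proof -
  have "{t. cos (t + a) = cos b}
    \<subseteq> (\<Union>i :: int. {b + 2 * of_int i * pi - a, - b + 2 * of_int i * pi - a})"
    by (auto simp: cos_eq elim!: Ints_cases) (metis add_diff_cancel)+
  thus ?thesis
    by (rule countable_subset) (intro countable_UN, auto)
qed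

lemma countable_singular: "countable (singular n k)"
proof -
  have "singular n k = {t. cos (t + (- pi / (2 * real n))) = cos (node n k)}
      \<union> {t. cos (t + pi / (2 * real n)) = cos (node n k)}"
    by (auto simp: singular_def)
  thus ?thesis
    by (simp only: countable_Un_iff countable_cos_eq)
qed

text \<open>Since \<open>n * h = pi / 2\<close>, the two shifts turn the cosine factor into sines of
  opposite sign. The average thus becomes a difference of reciprocals, whose numerator
  \<open>v - u\<close> carries the small factor \<open>sin h\<close>; this cancellation is the
  source of the quadratic decay.\<close>

lemma S_eq:
  assumes n: "1 \<le> n" and t: "t \<notin> singular n k"
  defines "h \<equiv> pi / (2 * real n)" and "\<theta> \<equiv> node n k"
  shows "S n k t = (-1) ^ k * sin \<theta> * sin (real n * t) * (sin t * sin h)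
           / (real n * ((cos h - cos (t - \<theta>)) * (cos h - cos (t + \<theta>))))"
proof -
  define u v where "u = cos (t - h) - cos \<theta>" and "v = cos (t + h) - cos \<theta>"
  have uv: "u \<noteq> 0" "v \<noteq> 0"
    using t by (auto simp: u_def v_def singular_def h_def \<theta>_def)
  have nh: "real n * h = pi / 2" using n by (simp add: h_def)
  have c: "cos (real n * (t - h)) = sin (real n * t)" "cos (real n * (t + h)) = - sin (real n * t)"
    by (simp_all add: right_diff_distrib distrib_left nh cos_diff cos_add)
  \<comment> \<open>In half-angle form the product consists of four sines, with arguments
    \<open>(t +- h +- \<theta>) / 2\<close>. Regrouping them separates a factor depending on
    \<open>t - \<theta>\<close> from one depending on \<open>t + \<theta>\<close>; the expansion
    verifies this regrouping.\<close>
  have "u * v = (cos t * cos h)\<^sup>2 - (sin t)\<^sup>2 * (sin h)\<^sup>2 - 2 * cos t * cos h * cos \<theta> + (cos \<theta>)\<^sup>2"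
    unfolding u_def v_def cos_add cos_diff by (simp add: power2_eq_square algebra_simps)
  also have "\<dots> = (cos h - cos t * cos \<theta>)\<^sup>2 - (sin t)\<^sup>2 * (sin \<theta>)\<^sup>2"
    unfolding sin_squared_eq power2_diff power_mult_distrib by (simp add: algebra_simps)
  also have "\<dots> = (cos h - cos (t - \<theta>)) * (cos h - cos (t + \<theta>))"
    unfolding cos_add cos_diff by (simp add: power2_eq_square algebra_simps)
  finally have prod: "u * v = (cos h - cos (t - \<theta>)) * (cos h - cos (t + \<theta>))" .
  have P_minus: "P n k (t - h) = (-1) ^ (k + 1) * (sin (real n * t) * sin \<theta>) / (real n * u)"
    using uv(1) unfolding P_def basis_quot_def \<theta>_def[symmetric] c u_def by simp
  have P_plus: "P n k (t + h) = (-1) ^ (k + 1) * (- sin (real n * t) * sin \<theta>) / (real n * v)"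
    using uv(2) unfolding P_def basis_quot_def \<theta>_def[symmetric] c v_def by simp
  have "S n k t = (-1) ^ (k + 1) * sin \<theta> * sin (real n * t) / (2 * real n) * (1 / u - 1 / v)"
    unfolding S_def h_def[symmetric] P_minus P_plus using uv n by (simp add: field_simps)
  also have "1 / u - 1 / v = (v - u) / (u * v)"
    using uv by (simp add: field_simps)
  also have "v - u = - 2 * (sin t * sin h)"
    by (simp add: u_def v_def cos_add cos_diff)
  finally show "S n k t = (-1) ^ k * sin \<theta> * sin (real n * t) * (sin t * sin h)
           / (real n * ((cos h - cos (t - \<theta>)) * (cos h - cos (t + \<theta>))))"
    unfolding prod by simp
qed

section \<open>Quadratic decay away from the node\<close>

lemma Jordan_sin:
  fixes x :: real
  assumes "0 \<le> x" "x \<le> pi / 2"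
  shows "2 / pi * x \<le> sin x"
proof -
  have "concave_on {0..pi / 2} sin"
    by (rule f''_le0_imp_concave[where f' = cos and f'' = "\<lambda>x. - sin x"])
       (auto intro!: derivative_eq_intros sin_ge_zero)
  from concave_onD[OF this, of "2 / pi * x" 0 "pi / 2"] show ?thesis
    using assms by (simp add: field_simps)
qed

text \<open>The difference of cosines is twice the product of the sines of
  \<open>(\<bar>u\<bar> - h) / 2\<close> and \<open>(\<bar>u\<bar> + h) / 2\<close>. The hypotheses
  put both angles in \<open>[0, pi / 2]\<close>, where Jordan's inequality applies.\<close>

lemma cos_diff_ge:
  fixes h u :: real
  assumes "0 \<le> h" "h \<le> \<bar>u\<bar>" "\<bar>u\<bar> + h \<le> pi"
  shows "2 * (u\<^sup>2 - h\<^sup>2) / pi\<^sup>2 \<le> cos h - cos u"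
proof -
  have "2 / pi * ((\<bar>u\<bar> - h) / 2) * (2 / pi * ((\<bar>u\<bar> + h) / 2))
      \<le> sin ((\<bar>u\<bar> - h) / 2) * sin ((\<bar>u\<bar> + h) / 2)"
    using assms by (intro mult_mono Jordan_sin sin_ge_zero) auto
  also have "\<dots> = (cos h - cos \<bar>u\<bar>) / 2"
    by (simp add: sin_times_sin field_simps)
  finally show ?thesis
    by (simp add: field_simps power2_eq_square)
qed

text \<open>The Cauchy (Lorentz) profile of width \<open>h\<close> and peak value 1. Its primitive
  \<open>h * arctan (u / h)\<close> makes both its integral and its sum over equally spaced points
  easy to bound.\<close>

definition weight :: "real \<Rightarrow> real \<Rightarrow> real" where
  "weight h u = h\<^sup>2 / (h\<^sup>2 + u\<^sup>2)"

lemma abs_S_le: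
  assumes k: "k \<in> {1..n}" and t: "t \<in> {0..pi}" "t \<notin> singular n k"
  defines "h \<equiv> pi / (2 * real n)"
  shows "\<bar>S n k t\<bar> \<le> 10 * weight h (t - node n k)"
proof -
  define \<theta> where "\<theta> = node n k"
  define u where "u = t - \<theta>"
  have n: "1 \<le> n" using k by auto
  have h: "0 < h" using n by (simp add: h_def)
  have \<theta>h: "\<theta> = (2 * real k - 1) * h"
    by (simp add: \<theta>_def node_def h_def)
  have "h * 1 \<le> h * (2 * real k - 1)" "h * (2 * real k - 1) \<le> h * (2 * real n - 1)"
    using k h by (intro mult_left_mono; simp)+
  moreover have "h * (2 * real n) = pi" using n by (simp add: h_def)
  \<comment> \<open>The nodes keep distance \<open>h\<close> from both endpoints, which ensures
    \<open>\<bar>t - \<theta>\<bar> + h \<le> pi\<close>, as the lower bound for the cosine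
    difference requires.\<close>
  ultimately have \<theta>: "h \<le> \<theta>" "\<theta> \<le> pi - h"
    by (simp_all add: \<theta>h algebra_simps)
  have "\<bar>S n k t\<bar> \<le> 10 * weight h u"
  proof (cases "2 * h \<le> \<bar>u\<bar>")
    case False
    hence "\<bar>u\<bar>\<^sup>2 \<le> (2 * h)\<^sup>2" by (intro power_mono) auto
    \<comment> \<open>Near the node the weight is at least 1/5, so the factor 10 turns it into a
      majorant of the uniform bound 2.\<close>
    hence "2 \<le> 10 * weight h u"
      using h by (simp add: weight_def field_simps add_pos_nonneg)
    moreover have "\<bar>S n k t\<bar> \<le> 2"
      using abs_P_le[OF n, of "t - h" k] abs_P_le[OF n, of "t + h" k] t(2)
      unfolding S_def singular_def h_def[symmetric] by auto
    ultimately show ?thesis by simp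
  next
    case True
    define Q R r where "Q = cos h - cos u" and "R = cos h - cos (t + \<theta>)" and "r = sin \<theta> * sin t"
    have u_h: "4 * h\<^sup>2 \<le> u\<^sup>2"
      using power_mono[OF True, of 2] h by simp
    have Q_ge: "2 * (u\<^sup>2 - h\<^sup>2) / pi\<^sup>2 \<le> Q"
      unfolding Q_def using h True \<theta> t by (intro cos_diff_ge) (auto simp: u_def)
    have "0 < h\<^sup>2" using h by simp
    hence u2: "0 < u\<^sup>2 - h\<^sup>2" using u_h by linarith
    hence d: "0 < 2 * (u\<^sup>2 - h\<^sup>2) / pi\<^sup>2" by simp
    hence Q: "0 < Q" using Q_ge by (rule less_le_trans)
    have "1 / Q \<le> 1 / (2 * (u\<^sup>2 - h\<^sup>2) / pi\<^sup>2)"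
      using Q_ge d Q by (intro divide_left_mono mult_pos_pos) auto
    hence Qle: "1 / Q \<le> pi\<^sup>2 / (2 * (u\<^sup>2 - h\<^sup>2))" by simp
    have r: "0 \<le> r"
      unfolding r_def using \<theta> t h by (intro mult_nonneg_nonneg sin_ge_zero) auto
    \<comment> \<open>As \<open>Q\<close> is positive, this gives \<open>r / R \<le> 1 / 2\<close>:
      the factor depending on \<open>t + \<theta>\<close> is absorbed by the two sines, even close
      to the endpoints of the interval.\<close>
    have R: "R = 2 * r + Q"
      by (simp add: R_def r_def Q_def u_def cos_add cos_diff)
    have sh: "0 \<le> sin h" "sin h \<le> h"
      using h \<theta> by (auto intro!: sin_ge_zero sin_x_le_x)
    have r_abs: "\<bar>sin \<theta>\<bar> * \<bar>sin t\<bar> = r"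
      using r by (simp add: r_def flip: abs_mult)
    have "\<bar>S n k t\<bar> = r * \<bar>sin (real n * t)\<bar> * sin h / (real n * (Q * R))"
      using S_eq[OF n t(2)] Q r r_abs sh(1) n R
      by (simp add: h_def[symmetric] \<theta>_def[symmetric] abs_mult u_def[symmetric] Q_def[symmetric]
          R_def[symmetric])
    also have "\<dots> \<le> r * 1 * h / (real n * (Q * R))"
      using r sh n Q R by (intro divide_right_mono mult_mono) auto
    also have "\<dots> = (r / R) * (1 / Q) * (h / real n)"
      by simp
    also have "\<dots> \<le> 1 / 2 * (pi\<^sup>2 / (2 * (u\<^sup>2 - h\<^sup>2))) * (h / real n)"
      using Qle Q R r h n by (intro mult_right_mono mult_mono) (auto simp: field_simps)
    also have "h / real n = 2 * h\<^sup>2 / pi"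
      using n by (simp add: h_def power2_eq_square)
    also have "1 / 2 * (pi\<^sup>2 / (2 * (u\<^sup>2 - h\<^sup>2))) * (2 * h\<^sup>2 / pi) = (pi / 2) * h\<^sup>2 / (u\<^sup>2 - h\<^sup>2)"
      using u2 by (simp add: field_simps power2_eq_square)
    also have "\<dots> \<le> 2 * h\<^sup>2 / (u\<^sup>2 - h\<^sup>2)"
      using u2 pi_less_4 by (intro divide_right_mono mult_right_mono) auto
    \<comment> \<open>From \<open>4 * h\<^sup>2 \<le> u\<^sup>2\<close> it follows that
      \<open>u\<^sup>2 - h\<^sup>2\<close> is at least a fifth of
      \<open>h\<^sup>2 + u\<^sup>2\<close>; the fifth reproduces the constant 10 of the near
      case.\<close>
    also have "\<dots> \<le> 2 * h\<^sup>2 / ((h\<^sup>2 + u\<^sup>2) / 5)"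
      using u2 u_h h by (intro divide_left_mono mult_pos_pos) (auto simp: add_pos_nonneg)
    also have "\<dots> = 10 * weight h u"
      by (simp add: weight_def)
    finally show ?thesis .
  qed
  thus ?thesis by (simp add: u_def \<theta>_def)
qed

section \<open>Sum of the weights over the nodes and integral of one weight\<close>

lemma sum_weight_le:
  assumes h: "0 < h"
  shows "(\<Sum>k = 1..n. weight h (t - (2 * real k - 1) * h)) \<le> 3 / 2 * pi"
proof -
  define s where "s = t / h"
  \<comment> \<open>In units of \<open>h\<close>, the windows of radius 1 around the points
    \<open>s - (2 * k - 1)\<close> abut at the points \<open>s - 2 * k\<close>. Comparing each
    weight with the increment of arctan over its window therefore produces a telescoping
    sum.\<close>
  define F where "F = (\<lambda>k::nat. arctan (s - 2 * real k))"
  \<comment> \<open>The increment is \<open>2 / (1 + z\<^sup>2)\<close> for some \<open>z\<close>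
    within distance 1 of \<open>x\<close>. There \<open>z\<^sup>2 \<le> 2 + 2 * x\<^sup>2\<close>,
    so \<open>1 + z\<^sup>2\<close> is at most three times \<open>1 + x\<^sup>2\<close>; this gives
    the constant 3/2.\<close>
  have arctan: "1 / (1 + x\<^sup>2) \<le> 3 / 2 * (arctan (x + 1) - arctan (x - 1))" for x :: real
  proof -
    obtain z where z: "x - 1 < z" "z < x + 1"
      "arctan (x + 1) - arctan (x - 1) = (x + 1 - (x - 1)) * inverse (1 + z\<^sup>2)"
      using MVT2[of "x - 1" "x + 1" arctan "\<lambda>z. inverse (1 + z\<^sup>2)"] DERIV_arctan by auto
    have "z\<^sup>2 = (z - x)\<^sup>2 + x\<^sup>2 + 2 * ((z - x) * x)"
      by (simp add: power2_eq_square algebra_simps)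
    moreover have "(z - x)\<^sup>2 \<le> 1"
      using z by (auto simp: abs_square_le_1)
    moreover have "2 * ((z - x) * x) \<le> (z - x)\<^sup>2 + x\<^sup>2"
      using sum_squares_bound[of "z - x" x] by (simp only: mult.assoc)
    ultimately have "1 + z\<^sup>2 \<le> 3 * (1 + x\<^sup>2)"
      using zero_le_power2[of x] unfolding distrib_left by linarith
    thus ?thesis
      using z(3) by (simp add: field_simps add_pos_nonneg)
  qed
  have "weight h (t - (2 * real k - 1) * h) \<le> 3 / 2 * (F (k - 1) - F k)" if "k \<in> {1..n}" for k
  proof -
    have "weight h (t - (2 * real k - 1) * h) = 1 / (1 + (s - (2 * real k - 1))\<^sup>2)"
    proof -
      have "t - (2 * real k - 1) * h = h * (s - (2 * real k - 1))"
        using h by (simp add: s_def field_simps)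
      hence "weight h (t - (2 * real k - 1) * h) = h\<^sup>2 * 1 / (h\<^sup>2 * (1 + (s - (2 * real k - 1))\<^sup>2))"
        unfolding weight_def by (simp add: power_mult_distrib distrib_left)
      thus ?thesis using h by simp
    qed
    also note arctan
    finally show ?thesis
      using that by (simp add: F_def of_nat_diff algebra_simps)
  qed
  hence "(\<Sum>k = 1..n. weight h (t - (2 * real k - 1) * h)) \<le> (\<Sum>k = 1..n. 3 / 2 * (F (k - 1) - F k))"
    by (rule sum_mono)
  also have "\<dots> = 3 / 2 * (F 0 - F n)"
    by (induction n) (auto simp: algebra_simps)
  also have "\<dots> \<le> 3 / 2 * pi"
    using arctan_bounded[of s] arctan_bounded[of "s - 2 * real n"]
    unfolding F_def by simp
  finally show ?thesis .
qed

lemma integrable_weight: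
  assumes h: "0 < h"
  shows "integrable (lebesgue_on {a..b}) (\<lambda>t. weight h (t - \<theta>))"
proof (rule continuous_imp_integrable_real)
  have "h\<^sup>2 + (t - \<theta>)\<^sup>2 \<noteq> 0" for t
    using h by (simp add: sum_power2_eq_zero_iff)
  thus "continuous_on {a..b} (\<lambda>t. weight h (t - \<theta>))"
    unfolding weight_def by (intro continuous_intros ballI)
qed

text \<open>Arctan increases by less than \<open>pi\<close> in total. For
  \<open>h = pi / (2 * n)\<close> the bound is of order \<open>1 / n\<close>, which offsets the
  prefactor \<open>n / pi\<close> of the operator.\<close>

lemma integral_weight_le:
  assumes h: "0 < h" and ab: "a \<le> b"
  shows "(\<integral>t. weight h (t - \<theta>) \<partial>lebesgue_on {a..b}) \<le> pi * h"
proof -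
  define F where "F = (\<lambda>t. h * arctan ((t - \<theta>) / h))"
  have "((\<lambda>t. weight h (t - \<theta>)) has_integral (F b - F a)) {a..b}"
  proof (rule fundamental_theorem_of_calculus[OF ab])
    fix t
    have "(F has_real_derivative weight h (t - \<theta>)) (at t within {a..b})"
      unfolding F_def weight_def using h
      by (auto intro!: derivative_eq_intros simp: field_simps power2_eq_square add_pos_nonneg)
    thus "(F has_vector_derivative weight h (t - \<theta>)) (at t within {a..b})"
      by (simp add: has_real_derivative_iff_has_vector_derivative)
  qed
  hence "(\<integral>t. weight h (t - \<theta>) \<partial>lebesgue_on {a..b}) = F b - F a"
    by (intro has_integral_unique[OF has_integral_integral_lebesgue_on[OF integrable_weight[OF h]]])
       auto
  also have "\<dots> = h * (arctan ((b - \<theta>) / h) - arctan ((a - \<theta>) / h))"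
    by (simp add: F_def right_diff_distrib)
  also have "\<dots> \<le> h * pi"
    using h arctan_bounded[of "(b - \<theta>) / h"] arctan_bounded[of "(a - \<theta>) / h"]
    by (intro mult_left_mono) auto
  finally show ?thesis by (simp add: mult.commute)
qed

text \<open>Outside the countable set \<open>singular n k\<close> the function agrees with an
  average of plain quotients, which is Borel; changing a Borel function on a countable set keeps it
  Borel.\<close>

lemma measurable_S:
  assumes n: "1 \<le> n"
  shows "S n k \<in> borel_measurable (lebesgue_on {0..pi})"
proof -
  have "S n k \<in> borel_measurable borel"
  proof (rule measurable_discrete_difference[OF _ countable_singular[of n k]])
    show "(\<lambda>t. (basis_quot n k (t - pi / (2 * real n)) + basis_quot n k (t + pi / (2 * real n))) / 2)
        \<in> borel_measurable borel"
      unfolding basis_quot_def by measurable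
  qed (auto simp: S_def P_def singular_def)
  hence "S n k \<in> borel_measurable lebesgue"
    by (simp add: measurable_completion)
  thus ?thesis by (rule measurable_restrict_space1)
qed

section \<open>Uniform boundedness of the operators\<close>

theorem lemma4p3:
  fixes p :: real
  assumes "1 < p"
  shows "\<exists>C>0. \<forall>n\<ge>1. \<forall>f\<in>Lp_space p.
           grunwald_durrmeyer n f \<in> Lp_space p \<and>
           Lp_norm p (grunwald_durrmeyer n f) \<le> C * Lp_norm p f"
\<comment> \<open>The constant is \<open>n / pi\<close> times the Schur bound: the weights
  \<open>w\<close> sum to at most \<open>10 * (3 / 2 * pi)\<close> and each has integral at most
  \<open>10 * (pi * h)\<close>. With \<open>h = pi / (2 * n)\<close> the dependence on
  \<open>n\<close> cancels.\<close>
proof (intro exI[of _ "75 * pi\<^sup>2"] conjI allI impI ballI)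
  fix n :: nat and f assume n: "1 \<le> n" and f: "f \<in> Lp_space p"
  let ?M = "lebesgue_on {0..pi}"
  define h where "h = pi / (2 * real n)"
  define w where "w = (\<lambda>k t. 10 * weight h (t - node n k))"
  define T where "T = (\<lambda>x. \<Sum>k\<in>{1..n}. S n k x * (\<integral>t. f t * S n k t \<partial>?M))"
  have h: "0 < h" using n by (simp add: h_def)
  have node: "node n k = (2 * real k - 1) * h" for k
    by (simp add: node_def h_def)
  have mf: "f \<in> borel_measurable ?M" and fp: "integrable ?M (\<lambda>t. \<bar>f t\<bar> powr p)"
    using f by (auto simp: Lp_space_def)
  have Sw: "AE t in ?M. \<bar>S n k t\<bar> \<le> w k t" if "k \<in> {1..n}" for k
  proof (rule AE_I')
    have "singular n k \<in> null_sets lebesgue"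
      by (simp add: countable_singular countable_imp_null_set_lborel null_sets_completionI)
    thus "singular n k \<inter> {0..pi} \<in> null_sets ?M"
      by (auto simp: null_sets_restrict_space null_set_Int2)
    show "{t \<in> space ?M. \<not> \<bar>S n k t\<bar> \<le> w k t} \<subseteq> singular n k \<inter> {0..pi}"
      using abs_S_le[OF that] by (auto simp: w_def h_def)
  qed
  have sumw: "(\<Sum>k\<in>{1..n}. w k t) \<le> 15 * pi" for t
    using sum_weight_le[OF h, of t n] by (simp add: w_def node sum_distrib_left[symmetric])
  have intw: "(\<integral>t. w k t \<partial>?M) \<le> 10 * (pi * h)" for k
    using integral_weight_le[OF h, of 0 pi "node n k"] by (simp add: w_def)
  have w0: "0 \<le> w k t" for k t
    by (simp add: w_def weight_def)
  have iw: "integrable ?M (w k)" for k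
    unfolding w_def using integrable_weight[OF h] by simp
  have pos: "0 < 15 * pi" "0 < 10 * (pi * h)" using h by auto
  note bound =
    finite_rank_powr_bound[where s = "S n" and w = w,
      OF assms pos finite_atLeastAtMost measurable_S[OF n] Sw w0 iw
      sumw intw mf fp]
  have T: "integrable ?M (\<lambda>x. \<bar>T x\<bar> powr p)"
    "(\<integral>x. \<bar>T x\<bar> powr p \<partial>?M)
      \<le> (15 * pi * (10 * (pi * h))) powr p * (\<integral>x. \<bar>f x\<bar> powr p \<partial>?M)"
    unfolding T_def by (rule bound; assumption)+
  have D: "grunwald_durrmeyer n f = (\<lambda>x. real n / pi * T x)"
    by (simp add: grunwald_durrmeyer_def T_def fun_eq_iff)
  have powr_D: "\<bar>real n / pi * T x\<bar> powr p = (real n / pi) powr p * \<bar>T x\<bar> powr p" for x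
    unfolding powr_mult[symmetric] by (simp add: abs_mult)
  have mT: "T \<in> borel_measurable ?M"
    unfolding T_def using measurable_S[OF n] by (intro borel_measurable_sum) auto
  have "integrable ?M (\<lambda>x. \<bar>real n / pi * T x\<bar> powr p)"
    unfolding powr_D using T(1) by simp
  thus "grunwald_durrmeyer n f \<in> Lp_space p"
    unfolding Lp_space_def D using mT by simp
  have "(\<integral>x. \<bar>grunwald_durrmeyer n f x\<bar> powr p \<partial>?M)
      = (real n / pi) powr p * (\<integral>x. \<bar>T x\<bar> powr p \<partial>?M)"
    unfolding D powr_D by simp
  also have "\<dots> \<le> (real n / pi) powr p *
      ((15 * pi * (10 * (pi * h))) powr p * (\<integral>x. \<bar>f x\<bar> powr p \<partial>?M))"
    by (intro mult_left_mono T(2)) auto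
  also have "\<dots> = (real n / pi * (15 * pi * (10 * (pi * h)))) powr p * (\<integral>x. \<bar>f x\<bar> powr p \<partial>?M)"
    by (simp only: powr_mult mult.assoc)
  also have "real n / pi * (15 * pi * (10 * (pi * h))) = 75 * pi\<^sup>2"
    using n by (simp add: h_def power2_eq_square)
  finally have "(\<integral>x. \<bar>grunwald_durrmeyer n f x\<bar> powr p \<partial>?M) powr (1 / p)
      \<le> ((75 * pi\<^sup>2) powr p * (\<integral>x. \<bar>f x\<bar> powr p \<partial>?M)) powr (1 / p)"
    using assms by (intro powr_mono2 Bochner_Integration.integral_nonneg) auto
  also have "\<dots> = 75 * pi\<^sup>2 * (\<integral>x. \<bar>f x\<bar> powr p \<partial>?M) powr (1 / p)"
    using assms by (subst powr_mult) (auto simp: powr_powr)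
  finally show "Lp_norm p (grunwald_durrmeyer n f) \<le> 75 * pi\<^sup>2 * Lp_norm p f"
    by (simp add: Lp_norm_def)
qed simp

end
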